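(* Consider the viewport-adaptive streaming model, the per-segment functions $\widetilde Q_i$, the feedback sets $\mathcal I_i$, and the OBS360 algorithm described in the context, with $\mathcal I=\{1,\dots,I\}$. Let the bitrate set $\mathcal R$ be convex. Suppose the time-varying parameters (the downloading capacity $d(t)$ and the FoV fractions $\omega_{i,k}$) are such that there exist nonnegative numbers $V_\emptyset$ and $V_r$ for which, for any number of segments $I$, $$\sum_{i\in\mathcal I\cup\{I+1\}}\mathbf 1(\mathcal I_i=\emptyset)\le V_\emptyset\qquad\text{and}\qquad \sum_{i\in\mathcal I\cup\{I+1\}}|\mathcal I_i|\,\lVert \boldsymbol r^*_{J_i}-\boldsymbol r^*_{J_i^\dagger}\rVert\le V_r .$$ Let $\alpha_0>0$ be a constant and $\gamma\in(1,\infty)$. If, for each $I$, the OBS360 algorithm is run with $\alpha=\alpha_0 I^{-1/\gamma}$, then its dynamic regret $\mathrm{Reg}_I=\sum_{i\in\mathcal I}\big(\widetilde Q_i(\boldsymbol r_i^* )-\widetilde Q_i(\boldsymbol r_i^o)\big)$ is sublinear, i.e. $$\lim_{I\to\infty}\frac{\mathrm{Reg}_I}{I}=0 .$$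
   Context: Streaming model. A video consists of segments $i\in\mathcal I=\{1,\dots,I\}$, each of playback length $\beta>0$ seconds, and each segment consists of tiles $k\in\mathcal K=\{1,\dots,K\}$. For tile $k$ of segment $i$ a bitrate $r_{i,k}\in\mathcal R$ is chosen, where $\mathcal R$ is a set of positive bitrates with largest element $R_{|\mathcal R|}$; write $\boldsymbol r_i=(r_{i,k})_{k\in\mathcal K}\in\mathcal R^K$. The size of a tile with bitrate $r$ is $r\beta$. The downloading capacity at time $t$ is $d(t)\in[d^{\min},d^{\max}]$ with $d^{\min}>0$. Tiles are downloaded one after another without pause, in lexicographic order of $(i,k)$, starting at time $0$; if tile $(i,k)$ is downloaded from time $\tau_{i,k}$ to $\hat\tau_{i,k}$, then $r_{i,k}\beta\le\int_{\tau_{i,k}}^{\hat\tau_{i,k}}d(t)\,dt$. The buffer occupancy (in seconds of playback) after all tiles of segment $i$ are downloaded is $b_i=[b_{i-1}-(\hat\tau_{i,K}-\tau_{i,1})]^++\beta$, where $b_0$ is a given initial occupancy and $[x]^+=\max\{x,0\}$. Segments are viewed in order; a segment is viewed only after it is downloaded, and playback freezes when the buffer is empty. The bitrate decisions are made sequentially in $i$, the decision of segment $i$ being made before segment $i$ is downloaded. Per-segment function. Let $\omega_{i,k}\ge 0$ be the fraction of tile $(i,k)$ overlapped with the user's field of view (FoV) (with $\sum_k\omega_{i,k}>0$), $\mu_i(\boldsymbol r_i)=\sum_{k\in\mathcal K}\omega_{i,k}r_{i,k}$, $u_i$ a nondecreasing concave function, $\bar d_i$ the average downloading capacity while segment $i$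 is being downloaded (treated as a given constant of segment $i$), and $l^{\mathrm{rb}},l^{\mathrm{bd\text{-}a}},l^{\mathrm{bd\text{-}e}}\ge 0$ constants. Given $\boldsymbol r_{i-1}$ and $b_{i-1}$, define $$\widetilde Q_i(\boldsymbol r_i)=u_i(\mu_i(\boldsymbol r_i))-l^{\mathrm{rb}}\Big(\tfrac{1}{\bar d_i}\sum_{k}r_{i,k}\beta-b_{i-1}\Big)-l^{\mathrm{bd\text{-}a}}\sum_{k}\omega_{i,k}\Big[\tfrac{\mu_i(\boldsymbol r_i)}{\sum_{k'}\omega_{i,k'}}-r_{i,k}\Big]^+-l^{\mathrm{bd\text{-}e}}\big(\mu_{i-1}(\boldsymbol r_{i-1})-\mu_i(\boldsymbol r_i)\big).$$ This is concave in $\boldsymbol r_i$; $\nabla\widetilde Q_i(\boldsymbol r_i)$ denotes a (fixed choice of) subgradient of it, in the sense of concave functions. $\boldsymbol r_i^*$ denotes a maximizer of $\widetilde Q_i$ over $\mathcal R^K$. Norms are Euclidean. Feedback sets. For each segment $i$, $\tilde I_i$ is the index such that segment $i$ has been viewed by the user during the time period between the bitrate decisions of segments $\tilde I_i$ and $\tilde I_i+1$ (so the FoV and capacity information of segment $i$ is available when segment $\tilde I_i+1$ is decided). For $i\in\mathcal I\cup\{I+1\}$ let $\mathcal I_i=\{i'\in\mathcal I: \tilde I_{i'}=i-1\}$. OBS360 algorithm. Initialize with any $\boldsymbol r_0\in\mathcal R^K$ (and $\boldsymbol r_0^o=\boldsymbol r_0$) and $\alpha>0$. For $i=1,2,\dots$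 (including $i=I+1$): if $\mathcal I_i\ne\emptyset$, let $J_i\in\arg\min_{j\in\mathcal I_i}-\nabla\widetilde Q_j(\boldsymbol r_j^o)^\top(\boldsymbol r_j^*-\boldsymbol r_j^o)$ and $$\boldsymbol r_i^o=\arg\min_{\boldsymbol r_i\in\mathcal R^K}\;-\nabla\widetilde Q_{J_i}(\boldsymbol r_{J_i}^o)^\top(\boldsymbol r_i-\boldsymbol r_{J_i}^o)+\frac1{2\alpha}\lVert\boldsymbol r_i-\boldsymbol r_{J_i}^o\rVert^2;$$ if $\mathcal I_i=\emptyset$, set $\boldsymbol r_i^o=\boldsymbol r_{i-1}^o$. If $\mathcal I_i=\emptyset$, define $J_i=J_{h(i)}$, where $h(i)<i$ is the last index before $i$ with $\mathcal I_{h(i)}\ne\emptyset$. Define $J_i^\dagger=J_{i'}$ with $i'=J_i$. Convention: when no such $h(i)$ exists, $J_i=0$, also $J_0=0$, and $\boldsymbol r_0^*$ is an arbitrary fixed point of $\mathcal R^K$. Constants. It is assumed that there is a constant $\overline Q$ (independent of $I$) with $\lVert\nabla\widetilde Q_i(\boldsymbol r_i)\rVert\le\overline Q$ for all $i$ and all $\boldsymbol r_i\in\mathcal R^K$, and a constant $R$ with $\lVert\boldsymbol r-\boldsymbol r'\rVert\le R$ for all $\boldsymbol r,\boldsymbol r'\in\mathcal R^K$. The set $\mathcal R$ is assumed closed and bounded so that the minimizers and maximizers above exist. The quantities $K,\mathcal R,\beta,d^{\min},d^{\max}$ do not depend on $I$. *)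

theory Defs
  imports "HOL-Analysis.Analysis"
begin

text \<open>
  Segments are the naturals \<open>1, \<dots>, I\<close>; index \<open>0\<close> carries the initial data. The tiles of a segment
  are the elements of a finite linearly ordered type \<open>'k\<close>, so that \<open>Min UNIV\<close> is the first and
  \<open>Max UNIV\<close> the last tile, and the bitrates of one segment form a vector in \<open>real ^ 'k\<close>.
\<close>

record ('k) stream_env =
  utility :: "nat \<Rightarrow> real \<Rightarrow> real"
  fov :: "nat \<Rightarrow> 'k \<Rightarrow> real"
  capacity :: "real \<Rightarrow> real"
  init_buffer :: real
  l_rb :: real
  l_bda :: real
  l_bde :: real

text \<open>
  One execution of the algorithm: decisions \<open>r\<^sub>i\<^sup>o\<close>, download intervals of the tiles, times of the
  bitrate decisions, the indices telling when a segment has been viewed, the choice of subgradients,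
  the maximizers \<open>r\<^sub>i\<^sup>*\<close> and the indices \<open>J\<^sub>i\<close>.
\<close>

record ('k::finite) stream_run =
  bitrate :: "nat \<Rightarrow> real ^ 'k"
  dl_start :: "nat \<Rightarrow> 'k \<Rightarrow> real"
  dl_end :: "nat \<Rightarrow> 'k \<Rightarrow> real"
  decision_time :: "nat \<Rightarrow> real"
  viewed_index :: "nat \<Rightarrow> nat"
  subgrad :: "nat \<Rightarrow> real ^ 'k \<Rightarrow> real ^ 'k"
  best :: "nat \<Rightarrow> real ^ 'k"
  Jidx :: "nat \<Rightarrow> nat"

definition bitrate_set :: "real set \<Rightarrow> bool" where
  "bitrate_set \<R> \<longleftrightarrow> \<R> \<noteq> {} \<and> (\<forall>r\<in>\<R>. 0 < r) \<and> closed \<R> \<and> bounded \<R>"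

definition bitrate_vectors :: "real set \<Rightarrow> (real ^ 'k::finite) set" where
  "bitrate_vectors \<R> = {r. \<forall>k. r $ k \<in> \<R>}"


subsection \<open>Environment\<close>

text \<open>
  The utilities only have to be defined on positive arguments, because the viewed quality
  is positive for positive bitrates.
\<close>

definition valid_env :: "real \<Rightarrow> real \<Rightarrow> nat \<Rightarrow> 'k::finite stream_env \<Rightarrow> bool" where
  "valid_env dmin dmax I E \<longleftrightarrow>
     (\<forall>t\<ge>0. capacity E t \<in> {dmin..dmax}) \<and>
     (\<forall>T. capacity E integrable_on {0..T}) \<and>
     (\<forall>i\<in>{1..I}. (\<forall>k. 0 \<le> fov E i k) \<and> 0 < (\<Sum>k\<in>UNIV. fov E i k)) \<and>
     (\<forall>i\<in>{1..I}. mono_on {0<..} (utility E i) \<and> concave_on {0<..} (utility E i)) \<and>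
     0 \<le> l_rb E \<and> 0 \<le> l_bda E \<and> 0 \<le> l_bde E"

definition mu :: "'k::finite stream_env \<Rightarrow> nat \<Rightarrow> real ^ 'k \<Rightarrow> real" where
  "mu E i r = (\<Sum>k\<in>UNIV. fov E i k * r $ k)"

definition segment_quality ::
  "real \<Rightarrow> 'k::finite stream_env \<Rightarrow> nat \<Rightarrow> real \<Rightarrow> real ^ 'k \<Rightarrow> real \<Rightarrow> real ^ 'k \<Rightarrow> real" where
  "segment_quality \<beta> E i dbar rprev bprev r =
     utility E i (mu E i r)
     - l_rb E * (1 / dbar * (\<Sum>k\<in>UNIV. r $ k * \<beta>) - bprev)
     - l_bda E * (\<Sum>k\<in>UNIV. fov E i k * max (mu E i r / (\<Sum>k'\<in>UNIV. fov E i k') - r $ k) 0)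
     - l_bde E * (mu E (i - 1) rprev - mu E i r)"


subsection \<open>Download, buffer and playback\<close>

definition seg_start :: "'k::{finite,linorder} stream_run \<Rightarrow> nat \<Rightarrow> real" where
  "seg_start S i = dl_start S i (Min UNIV)"

definition seg_end :: "'k::{finite,linorder} stream_run \<Rightarrow> nat \<Rightarrow> real" where
  "seg_end S i = dl_end S i (Max UNIV)"

definition valid_download ::
  "real \<Rightarrow> nat \<Rightarrow> 'k::{finite,linorder} stream_env \<Rightarrow> 'k stream_run \<Rightarrow> bool" where
  "valid_download \<beta> I E S \<longleftrightarrow>
     seg_start S 1 = 0 \<and>
     (\<forall>i\<in>{1..I}. \<forall>k. dl_start S i k \<le> dl_end S i k \<and>
        bitrate S i $ k * \<beta> \<le> integral {dl_start S i k..dl_end S i k} (capacity E)) \<and>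
     (\<forall>i\<in>{1..I}. \<forall>k k'. k < k' \<and> \<not> (\<exists>j. k < j \<and> j < k') \<longrightarrow> dl_start S i k' = dl_end S i k) \<and>
     (\<forall>i\<in>{1..<I}. seg_start S (i + 1) = seg_end S i)"

definition avg_capacity :: "'k::{finite,linorder} stream_env \<Rightarrow> 'k stream_run \<Rightarrow> nat \<Rightarrow> real" where
  "avg_capacity E S i =
     integral {seg_start S i..seg_end S i} (capacity E) / (seg_end S i - seg_start S i)"

fun buffer :: "real \<Rightarrow> 'k::{finite,linorder} stream_env \<Rightarrow> 'k stream_run \<Rightarrow> nat \<Rightarrow> real" where
  "buffer \<beta> E S 0 = init_buffer E"
| "buffer \<beta> E S (Suc i) =
     max (buffer \<beta> E S i - (seg_end S (Suc i) - seg_start S (Suc i))) 0 + \<beta>"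

text \<open>
  The time at which the viewing of a segment is completed. Playback of the initial content starts at
  time \<open>0\<close>; a segment starts to play as soon as it is downloaded and its predecessor is finished,
  and playback freezes while waiting for the download. The lemma shows that this is the playback
  described by the buffer recursion.
\<close>

fun view_end :: "real \<Rightarrow> 'k::{finite,linorder} stream_env \<Rightarrow> 'k stream_run \<Rightarrow> nat \<Rightarrow> real" where
  "view_end \<beta> E S 0 = init_buffer E"
| "view_end \<beta> E S (Suc i) = max (seg_end S (Suc i)) (view_end \<beta> E S i) + \<beta>"

lemma view_end_eq_buffer:
  assumes "valid_download \<beta> I E S" "i \<in> {1..I}"
  shows "view_end \<beta> E S i = seg_end S i + buffer \<beta> E S i"
  using assms(2)
proof (induction i)
  case (Suc i)
  show ?case
  proof (cases "i = 0")
    case True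
    then show ?thesis using assms(1) by (simp add: valid_download_def)
  next
    case False
    then have "view_end \<beta> E S i = seg_end S i + buffer \<beta> E S i" using Suc by simp
    moreover have "seg_start S (Suc i) = seg_end S i"
      using assms(1) Suc.prems False by (simp add: valid_download_def)
    ultimately show ?thesis by simp
  qed
qed simp

text \<open>
  Segment \<open>i\<close> has been viewed between the decisions of the segments \<open>viewed_index S i\<close> and
  \<open>viewed_index S i + 1\<close>. No decision follows that of segment \<open>I\<close>, so the last period is unbounded.
  The weak inequalities leave open how coinciding times are resolved.
\<close>

definition valid_timing ::
  "real \<Rightarrow> nat \<Rightarrow> 'k::{finite,linorder} stream_env \<Rightarrow> 'k stream_run \<Rightarrow> bool" where
  "valid_timing \<beta> I E S \<longleftrightarrow>
     (\<forall>i\<in>{1..<I}. decision_time S i \<le> decision_time S (i + 1)) \<and>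
     (\<forall>i\<in>{1..I}. decision_time S i \<le> seg_start S i) \<and>
     (\<forall>i\<in>{1..I}. viewed_index S i \<in> {1..I} \<and>
        decision_time S (viewed_index S i) \<le> view_end \<beta> E S i \<and>
        (viewed_index S i < I \<longrightarrow> view_end \<beta> E S i \<le> decision_time S (viewed_index S i + 1)))"

definition feedback :: "nat \<Rightarrow> 'k::finite stream_run \<Rightarrow> nat \<Rightarrow> nat set" where
  "feedback I S i = {i'\<in>{1..I}. viewed_index S i' + 1 = i}"


subsection \<open>The algorithm\<close>

text \<open>The per-segment function given the previous bitrates and the buffer of the execution.\<close>

definition Qt ::
  "real \<Rightarrow> 'k::{finite,linorder} stream_env \<Rightarrow> 'k stream_run \<Rightarrow> nat \<Rightarrow> (real, 'k) vec \<Rightarrow> real" where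
  "Qt \<beta> E S i r =
     segment_quality \<beta> E i (avg_capacity E S i) (bitrate S (i - 1)) (buffer \<beta> E S (i - 1)) r"

text \<open>Subgradient, in the sense of concave functions, of a function considered on the set \<open>A\<close>.\<close>

definition concave_subgradient ::
  "'a::real_inner set \<Rightarrow> ('a \<Rightarrow> real) \<Rightarrow> 'a \<Rightarrow> 'a \<Rightarrow> bool" where
  "concave_subgradient A f x g \<longleftrightarrow> (\<forall>y\<in>A. f y \<le> f x + g \<bullet> (y - x))"

definition valid_J :: "nat \<Rightarrow> 'k::finite stream_run \<Rightarrow> bool" where
  "valid_J I S \<longleftrightarrow>
     Jidx S 0 = 0 \<and>
     (\<forall>i\<in>{1..I+1}.
        if feedback I S i \<noteq> {}
        then is_arg_min (\<lambda>j. - (subgrad S j (bitrate S j) \<bullet> (best S j - bitrate S j)))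
               (\<lambda>j. j \<in> feedback I S i) (Jidx S i)
        else if \<exists>h\<in>{1..<i}. feedback I S h \<noteq> {}
        then Jidx S i = Jidx S (Max {h\<in>{1..<i}. feedback I S h \<noteq> {}})
        else Jidx S i = 0)"

definition valid_update :: "real set \<Rightarrow> nat \<Rightarrow> real \<Rightarrow> 'k::finite stream_run \<Rightarrow> bool" where
  "valid_update \<R> I \<alpha> S \<longleftrightarrow>
     bitrate S 0 \<in> bitrate_vectors \<R> \<and>
     (\<forall>i\<in>{1..I+1}.
        if feedback I S i \<noteq> {}
        then is_arg_min
               (\<lambda>r. - (subgrad S (Jidx S i) (bitrate S (Jidx S i)) \<bullet> (r - bitrate S (Jidx S i)))
                    + 1 / (2 * \<alpha>) * (norm (r - bitrate S (Jidx S i)))\<^sup>2)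
               (\<lambda>r. r \<in> bitrate_vectors \<R>) (bitrate S i)
        else bitrate S i = bitrate S (i - 1))"

definition OBS360_run ::
  "real \<Rightarrow> real set \<Rightarrow> nat \<Rightarrow> real \<Rightarrow> 'k::{finite,linorder} stream_env \<Rightarrow> 'k stream_run \<Rightarrow> bool" where
  "OBS360_run \<beta> \<R> I \<alpha> E S \<longleftrightarrow>
     valid_download \<beta> I E S \<and> valid_timing \<beta> I E S \<and>
     (\<forall>i\<in>{1..I}. \<forall>r\<in>bitrate_vectors \<R>.
        concave_subgradient (bitrate_vectors \<R>) (Qt \<beta> E S i) r (subgrad S i r)) \<and>
     best S 0 \<in> bitrate_vectors \<R> \<and>
     (\<forall>i\<in>{1..I}. is_arg_max (Qt \<beta> E S i) (\<lambda>r. r \<in> bitrate_vectors \<R>) (best S i)) \<and>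
     valid_J I S \<and> valid_update \<R> I \<alpha> S"

definition dynamic_regret ::
  "real \<Rightarrow> nat \<Rightarrow> 'k::{finite,linorder} stream_env \<Rightarrow> 'k stream_run \<Rightarrow> real" where
  "dynamic_regret \<beta> I E S = (\<Sum>i\<in>{1..I}. Qt \<beta> E S i (best S i) - Qt \<beta> E S i (bitrate S i))"

end

(* Concavity and the choice of J_i bound the regret of every segment of the feedback set of i by the
   linearization at J_i, and the proximal step bounds this by (|r*_J - r_J|^2 - |r*_J - r_i|^2) / (2 alpha)
   + alpha Qbar^2 / 2 with J = J_i. Put a_i = |r*_{J_i} - r_i|^2. Replacing r*_J by r*_{J_J} in the first
   square costs the path variation V_r and leaves a_J - a_i. The feedback sets partition the I segments
   among I + 1 indices and i -> J_i is injective on the nonempty ones, so with at most V_0 of them empty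
   almost all have one element, and the weighted sum of the a_J - a_i telescopes up to O(V_0).
   Altogether the regret is O(1 / alpha + alpha I). *)
theory Submission
  imports Defs
begin

section \<open>Bitrate vectors and the proximal step\<close>

lemma convex_bitrate_vectors:
  assumes "convex \<R>"
  shows "convex (bitrate_vectors \<R>)"
  using assms by (auto simp: bitrate_vectors_def convex_def)

lemma closed_bitrate_vectors:
  assumes "closed \<R>"
  shows "closed (bitrate_vectors \<R> :: (real ^ 'k::finite) set)"
proof -
  have "bitrate_vectors \<R> = (\<Inter>k. (\<lambda>r. r $ k) -` \<R> :: (real ^ 'k) set)"
    by (auto simp: bitrate_vectors_def)
  moreover have "closed ((\<lambda>r. r $ k) -` \<R> :: (real ^ 'k) set)" for k
    using assms by (intro closed_vimage continuous_intros)
  ultimately show ?thesis by auto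
qed

text \<open>
  Completing the square turns the proximal step into the projection of \<open>x + \<alpha> *\<^sub>R g\<close> onto \<open>C\<close>.
\<close>

lemma proximal_step:
  fixes C :: "'a::euclidean_space set"
  assumes "convex C" "closed C" "0 < \<alpha>"
    and z: "is_arg_min (\<lambda>r. - (g \<bullet> (r - x)) + 1 / (2 * \<alpha>) * (norm (r - x))\<^sup>2) (\<lambda>r. r \<in> C) z"
    and u: "u \<in> C"
  shows "g \<bullet> (u - x) \<le> ((norm (u - x))\<^sup>2 - (norm (u - z))\<^sup>2) / (2 * \<alpha>) + \<alpha> / 2 * (norm g)\<^sup>2"
proof -
  let ?p = "x + \<alpha> *\<^sub>R g"
  have scale: "2 * \<alpha> * (- A + 1 / (2 * \<alpha>) * B) = B - 2 * \<alpha> * A" for A B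
    using \<open>0 < \<alpha>\<close> by (simp add: field_simps)
  have square: "(dist ?p r)\<^sup>2
      = 2 * \<alpha> * (- (g \<bullet> (r - x)) + 1 / (2 * \<alpha>) * (norm (r - x))\<^sup>2) + \<alpha>\<^sup>2 * (norm g)\<^sup>2" for r
    unfolding dist_norm scale power2_norm_eq_inner
    by (simp add: algebra_simps inner_commute power2_eq_square)
  have "z \<in> C" using z by (simp add: is_arg_min_linorder)
  have min: "- (g \<bullet> (z - x)) + 1 / (2 * \<alpha>) * (norm (z - x))\<^sup>2
      \<le> - (g \<bullet> (r - x)) + 1 / (2 * \<alpha>) * (norm (r - x))\<^sup>2" if "r \<in> C" for r
    using z that by (auto simp: is_arg_min_linorder)
  have "dist ?p z \<le> dist ?p r" if "r \<in> C" for r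
  proof -
    have "(dist ?p z)\<^sup>2 \<le> (dist ?p r)\<^sup>2"
      unfolding square using min[OF that] \<open>0 < \<alpha>\<close>
      by (intro add_right_mono mult_left_mono) auto
    then show ?thesis by (rule power2_le_imp_le) simp
  qed
  \<comment> \<open>\<open>z\<close> is a point of \<open>C\<close> closest to \<open>?p\<close>, so
    the variational inequality of the projection applies at \<open>u\<close>.\<close>
  then have "(?p - z) \<bullet> (u - z) \<le> 0"
    using any_closest_point_dot[OF assms(1,2) \<open>z \<in> C\<close> u] by blast
  \<comment> \<open>Expanded, this bounds \<open>2 * \<alpha> * (g \<bullet> (z - x))\<close> by
    \<open>(norm (z - x))\<^sup>2 + \<alpha>\<^sup>2 * (norm g)\<^sup>2\<close>; the square of
    \<open>z - x\<close> cancels against the one from the projection inequality.\<close>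
  moreover have "0 \<le> (norm (\<alpha> *\<^sub>R g - (z - x)))\<^sup>2" by simp
  ultimately have "2 * \<alpha> * (g \<bullet> (u - x)) \<le> (norm (u - x))\<^sup>2 - (norm (u - z))\<^sup>2 + \<alpha>\<^sup>2 * (norm g)\<^sup>2"
    unfolding power2_norm_eq_inner
    by (simp add: algebra_simps inner_commute power2_eq_square)
  then show ?thesis
    using \<open>0 < \<alpha>\<close> by (simp add: field_simps power2_eq_square)
qed

section \<open>Counting over the feedback sets\<close>

text \<open>Each segment \<open>j\<close> lies in exactly one feedback set, that of index
  \<open>viewed_index S j + 1\<close>. This index can reach \<open>I + 1\<close>, hence the range of
  the outer sum.\<close>

lemma sum_feedback:
  fixes f :: "nat \<Rightarrow> 'a::comm_monoid_add"
  assumes "\<And>j. j \<in> {1..I} \<Longrightarrow> viewed_index S j \<in> {1..I}"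
  shows "(\<Sum>i\<in>{1..I+1}. sum f (feedback I S i)) = sum f {1..I}"
  unfolding feedback_def
  using assms by (intro sum.group) fastforce+

lemma sum_card_feedback:
  assumes "\<And>j. j \<in> {1..I} \<Longrightarrow> viewed_index S j \<in> {1..I}"
  shows "(\<Sum>i\<in>{1..I+1}. real (card (feedback I S i))) = real I"
  using sum_feedback[OF assms, where f = "\<lambda>_. 1::real"] by simp

text \<open>Split each cardinality into 1 and an excess. The unit parts telescope because
  \<open>J\<close> is injective on the nonempty sets; the excesses add up to one less than the
  number of empty sets. Each of the two parts costs at most \<open>B\<close> per empty set.\<close>

lemma feedback_weighted_telescope:
  fixes a :: "nat \<Rightarrow> real"
  assumes viewed: "\<And>j. j \<in> {1..I} \<Longrightarrow> viewed_index S j \<in> {1..I}"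
    and J: "\<And>i. i \<in> {1..I+1} \<Longrightarrow> feedback I S i \<noteq> {} \<Longrightarrow> J i \<in> feedback I S i"
    and a: "\<And>i. i \<in> {1..I+1} \<Longrightarrow> 0 \<le> a i \<and> a i \<le> B"
  shows "(\<Sum>i | i \<in> {1..I+1} \<and> feedback I S i \<noteq> {}. real (card (feedback I S i)) * (a (J i) - a i))
     \<le> 2 * B * real (card {i\<in>{1..I+1}. feedback I S i = {}})"
proof -
  define N where "N = {i\<in>{1..I+1}. feedback I S i \<noteq> {}}"
  define Z where "Z = {i\<in>{1..I+1}. feedback I S i = {}}"
  let ?c = "\<lambda>i. real (card (feedback I S i))"
  have fin: "finite N" "finite Z" and NZ: "N \<union> Z = {1..I+1}" "N \<inter> Z = {}"
    by (auto simp: N_def Z_def)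
  have fin_fb: "finite (feedback I S i)" for i by (simp add: feedback_def)
  have "card N + card Z = I + 1"
    using card_Un_disjoint[OF fin NZ(2)] NZ(1) by simp
  then have card_NZ: "real (card N) + real (card Z) = real I + 1" by linarith
  have J_range: "J i \<in> {1..I}" if "i \<in> N" for i
    using J that by (auto simp: N_def feedback_def)
  \<comment> \<open>The index \<open>i\<close> is recovered from \<open>J i\<close>, as
    \<open>J i\<close> belongs to the feedback set of \<open>i\<close> only.\<close>
  have "inj_on J N"
    using J by (intro inj_on_inverseI[where g = "\<lambda>j. viewed_index S j + 1"])
      (auto simp: N_def feedback_def)
  have "B \<ge> 0" using a[of 1] by auto
  have "sum ?c {1..I+1} = real I"
    using sum_card_feedback[OF viewed] by simp
  moreover have "sum ?c {1..I+1} = sum ?c N"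
    by (intro sum.mono_neutral_right) (auto simp: N_def)
  ultimately have c_sum: "sum ?c N = real I" by simp
  have "(\<Sum>i\<in>N. (?c i - 1) * (a (J i) - a i)) \<le> (\<Sum>i\<in>N. (?c i - 1) * B)"
  proof (intro sum_mono mult_left_mono)
    fix i assume i: "i \<in> N"
    have "0 < card (feedback I S i)" using i fin_fb by (auto simp: N_def card_gt_0_iff)
    then show "0 \<le> ?c i - 1" by linarith
    show "a (J i) - a i \<le> B"
      using a[of "J i"] a[of i] J_range[OF i] i by (auto simp: N_def)
  qed
  \<comment> \<open>The cardinalities sum to \<open>I\<close>, and
    \<open>I - card N = card Z - 1\<close> since \<open>N\<close> and \<open>Z\<close> share
    \<open>I + 1\<close> indices.\<close>
  also have "\<dots> = (real (card Z) - 1) * B"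
    using c_sum card_NZ by (simp add: sum_distrib_right[symmetric] sum_subtractf)
  finally have excess: "(\<Sum>i\<in>N. (?c i - 1) * (a (J i) - a i)) \<le> (real (card Z) - 1) * B" .
  have "(\<Sum>i\<in>N. a (J i)) = sum a (J ` N)"
    using sum.reindex[OF \<open>inj_on J N\<close>, of a] by simp
  \<comment> \<open>Enlarging the image of \<open>J\<close> to all indices is allowed as
    \<open>a\<close> is nonnegative; the part over \<open>N\<close> will cancel, leaving only the
    indices in \<open>Z\<close>.\<close>
  also have "\<dots> \<le> sum a {1..I+1}"
    using J_range a by (intro sum_mono2) fastforce+
  also have "\<dots> = sum a N + sum a Z"
    using sum.union_disjoint[OF fin NZ(2), of a] NZ(1) by simp
  also have "sum a Z \<le> real (card Z) * B"
    using a by (intro sum_bounded_above) (auto simp: Z_def)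
  finally have "(\<Sum>i\<in>N. a (J i) - a i) \<le> real (card Z) * B" by (simp add: sum_subtractf)
  moreover have "(\<Sum>i\<in>N. ?c i * (a (J i) - a i))
      = (\<Sum>i\<in>N. (?c i - 1) * (a (J i) - a i)) + (\<Sum>i\<in>N. a (J i) - a i)"
    by (simp add: sum.distrib[symmetric] algebra_simps)
  \<comment> \<open>The two estimates add up to \<open>(2 * card Z - 1) * B\<close>; the surplus
    \<open>- B\<close> is dropped.\<close>
  ultimately have "(\<Sum>i\<in>N. ?c i * (a (J i) - a i)) \<le> 2 * B * real (card Z)"
    using excess \<open>B \<ge> 0\<close> by (simp add: algebra_simps)
  then show ?thesis by (simp add: N_def Z_def)
qed

section \<open>Structure of a single execution\<close>

context
  fixes \<beta> \<alpha> :: real and \<R> :: "real set" and I :: nat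
    and E :: "'k::{finite,linorder} stream_env" and S :: "'k stream_run"
  assumes run: "OBS360_run \<beta> \<R> I \<alpha> E S"
begin

lemma run_viewed_index: "j \<in> {1..I} \<Longrightarrow> viewed_index S j \<in> {1..I}"
  using run by (auto simp: OBS360_run_def valid_timing_def)

lemma run_update:
  assumes "i \<in> {1..I+1}" "feedback I S i \<noteq> {}"
  shows "is_arg_min
    (\<lambda>r. - (subgrad S (Jidx S i) (bitrate S (Jidx S i)) \<bullet> (r - bitrate S (Jidx S i)))
      + 1 / (2 * \<alpha>) * (norm (r - bitrate S (Jidx S i)))\<^sup>2)
    (\<lambda>r. r \<in> bitrate_vectors \<R>) (bitrate S i)"
  using run assms unfolding OBS360_run_def valid_update_def by presburger

lemma run_bitrate: "i \<le> I + 1 \<Longrightarrow> bitrate S i \<in> bitrate_vectors \<R>"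
proof (induction i)
  case 0
  then show ?case using run by (simp add: OBS360_run_def valid_update_def)
next
  case (Suc i)
  show ?case
  proof (cases "feedback I S (Suc i) = {}")
    case True
    then have "bitrate S (Suc i) = bitrate S (Suc i - 1)"
      using run Suc.prems unfolding OBS360_run_def valid_update_def by force
    then show ?thesis using Suc by simp
  next
    case False
    then show ?thesis using run_update[of "Suc i"] Suc.prems by (simp add: is_arg_min_def)
  qed
qed

lemma run_best: "i \<le> I \<Longrightarrow> best S i \<in> bitrate_vectors \<R>"
  using run by (cases "i = 0") (auto simp: OBS360_run_def is_arg_max_def)

lemma run_Jidx:
  assumes "i \<in> {1..I+1}" "feedback I S i \<noteq> {}"
  shows "is_arg_min (\<lambda>j. - (subgrad S j (bitrate S j) \<bullet> (best S j - bitrate S j)))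
    (\<lambda>j. j \<in> feedback I S i) (Jidx S i)"
  using run assms by (auto simp: OBS360_run_def valid_J_def)

lemma run_Jidx_feedback:
  assumes "i \<in> {1..I+1}" "feedback I S i \<noteq> {}"
  shows "Jidx S i \<in> feedback I S i"
  using run_Jidx[OF assms] by (simp add: is_arg_min_def)

text \<open>Needed also where the feedback set is empty: \<open>Jidx S i\<close> may itself be such
  an index, and the best vector at \<open>Jidx S (Jidx S i)\<close> must still lie in the feasible
  set. There the value is inherited from an earlier nonempty set or is 0.\<close>

lemma run_Jidx_le:
  assumes "i \<le> I + 1"
  shows "Jidx S i \<le> I"
proof -
  have nonempty: "Jidx S h \<le> I" if "h \<in> {1..I+1}" "feedback I S h \<noteq> {}" for h
    using run_Jidx_feedback[OF that] by (simp add: feedback_def)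
  consider "i = 0" | "i \<in> {1..I+1}" "feedback I S i \<noteq> {}"
    | "i \<in> {1..I+1}" "feedback I S i = {}" using assms by fastforce
  then show ?thesis
  proof cases
    case 1
    then show ?thesis using run by (simp add: OBS360_run_def valid_J_def)
  next
    case 2
    then show ?thesis by (rule nonempty)
  next
    case 3
    let ?H = "{h\<in>{1..<i}. feedback I S h \<noteq> {}}"
    show ?thesis
    proof (cases "\<exists>h\<in>{1..<i}. feedback I S h \<noteq> {}")
      case True
      then have "Max ?H \<in> ?H" by (intro Max_in) auto
      moreover have "Jidx S i = Jidx S (Max ?H)"
        using run 3 True by (simp add: OBS360_run_def valid_J_def)
      ultimately show ?thesis using nonempty[of "Max ?H"] 3 by auto
    next
      case False
      then show ?thesis using run 3 by (simp add: OBS360_run_def valid_J_def)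
    qed
  qed
qed

section \<open>Regret of a single execution\<close>

lemma dynamic_regret_nonneg: "0 \<le> dynamic_regret \<beta> I E S"
  unfolding dynamic_regret_def
proof (intro sum_nonneg)
  fix i assume "i \<in> {1..I}"
  then show "0 \<le> Qt \<beta> E S i (best S i) - Qt \<beta> E S i (bitrate S i)"
    using run run_bitrate[of i] by (auto simp: OBS360_run_def is_arg_max_linorder)
qed

text \<open>By concavity the regret of a segment is at most its linearization.
  \<open>Jidx S i\<close> minimizes the negated linearization, so its value dominates those of all
  segments in the feedback set of \<open>i\<close>.\<close>

lemma dynamic_regret_le_linearized:
  "dynamic_regret \<beta> I E S \<le> (\<Sum>i | i \<in> {1..I+1} \<and> feedback I S i \<noteq> {}. real (card (feedback I S i)) *
     (subgrad S (Jidx S i) (bitrate S (Jidx S i)) \<bullet> (best S (Jidx S i) - bitrate S (Jidx S i))))"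
proof -
  define q where "q i = Qt \<beta> E S i (best S i) - Qt \<beta> E S i (bitrate S i)" for i
  define l where "l j = subgrad S j (bitrate S j) \<bullet> (best S j - bitrate S j)" for j
  have q_le: "q j \<le> l j" if "j \<in> {1..I}" for j
    using run that run_bitrate[of j] run_best[of j]
    by (auto simp: OBS360_run_def concave_subgradient_def q_def l_def algebra_simps)
  have "dynamic_regret \<beta> I E S = (\<Sum>i\<in>{1..I+1}. sum q (feedback I S i))"
    unfolding dynamic_regret_def q_def[symmetric]
    using sum_feedback[OF run_viewed_index, where f = q] by simp
  also have "\<dots> = (\<Sum>i | i \<in> {1..I+1} \<and> feedback I S i \<noteq> {}. sum q (feedback I S i))"
    by (intro sum.mono_neutral_right) auto
  also have "\<dots> \<le> (\<Sum>i | i \<in> {1..I+1} \<and> feedback I S i \<noteq> {}. real (card (feedback I S i)) * l (Jidx S i))"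
  proof (intro sum_mono sum_bounded_above)
    fix i j assume i: "i \<in> {i. i \<in> {1..I+1} \<and> feedback I S i \<noteq> {}}" and j: "j \<in> feedback I S i"
    have "l j \<le> l (Jidx S i)"
      using run_Jidx[of i] i j by (auto simp: is_arg_min_linorder l_def)
    then show "q j \<le> l (Jidx S i)"
      using q_le[of j] j by (simp add: feedback_def)
  qed
  finally show ?thesis by (simp add: l_def)
qed

lemma dynamic_regret_bound:
  assumes "closed \<R>" "convex \<R>" "0 < \<alpha>"
    and subgrad: "\<And>i r. i \<in> {1..I} \<Longrightarrow> r \<in> bitrate_vectors \<R> \<Longrightarrow> norm (subgrad S i r) \<le> Qbar"
    and diam: "\<And>r r'. r \<in> (bitrate_vectors \<R> :: (real, 'k) vec set) \<Longrightarrow> r' \<in> bitrate_vectors \<R>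
      \<Longrightarrow> norm (r - r') \<le> R"
    and empty: "(\<Sum>i\<in>{1..I+1}. if feedback I S i = {} then 1 else 0) \<le> V\<^sub>0"
    and drift: "(\<Sum>i\<in>{1..I+1}. real (card (feedback I S i)) *
      norm (best S (Jidx S i) - best S (Jidx S (Jidx S i)))) \<le> V\<^sub>r"
  shows "dynamic_regret \<beta> I E S \<le> (R * V\<^sub>r + R\<^sup>2 * V\<^sub>0) / \<alpha> + \<alpha> / 2 * Qbar\<^sup>2 * real I"
proof -
  define N where "N = {i. i \<in> {1..I+1} \<and> feedback I S i \<noteq> {}}"
  define a where "a i = (norm (best S (Jidx S i) - bitrate S i))\<^sup>2" for i
  define v where "v i = norm (best S (Jidx S i) - best S (Jidx S (Jidx S i)))" for i
  let ?J = "Jidx S" and ?c = "\<lambda>i. real (card (feedback I S i))"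
  have R: "0 \<le> R"
    using diam[OF run_bitrate[of 0] run_bitrate[of 0]] by simp
  have dist_le: "norm (best S j - bitrate S i) \<le> R" if "j \<le> I" "i \<le> I + 1" for i j
    using diam run_best run_bitrate that by blast
  have step: "subgrad S (?J i) (bitrate S (?J i)) \<bullet> (best S (?J i) - bitrate S (?J i))
      \<le> (a (?J i) - a i) / (2 * \<alpha>) + R / \<alpha> * v i + \<alpha> / 2 * Qbar\<^sup>2" (is "?g \<bullet> _ \<le> _") if "i \<in> N" for i
  proof -
    have J: "?J i \<in> {1..I}"
      using run_Jidx_feedback that by (auto simp: N_def feedback_def)
    have i: "i \<in> {1..I+1}" using that by (simp add: N_def)
    define d where "d = norm (best S (?J i) - bitrate S (?J i))"
    define e where "e = norm (best S (?J (?J i)) - bitrate S (?J i))"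
    have de: "0 \<le> d" "d \<le> R" "0 \<le> e" "e \<le> R"
      using dist_le run_Jidx_le J by (auto simp: d_def e_def)
    \<comment> \<open>Reverse triangle inequality; the common point \<open>bitrate S (?J i)\<close>
      cancels.\<close>
    have "d - e \<le> v i"
      using norm_triangle_ineq3[of "best S (?J i) - bitrate S (?J i)"
        "best S (?J (?J i)) - bitrate S (?J i)"]
      by (simp add: d_def e_def v_def)
    then have "(d + e) * (d - e) \<le> (d + e) * v i"
      using de by (intro mult_left_mono) auto
    also have "\<dots> \<le> 2 * R * v i"
      using de by (intro mult_right_mono) (auto simp: v_def)
    \<comment> \<open>Here \<open>e\<^sup>2\<close> is \<open>a (?J i)\<close>, and the left side is
      the difference of squares \<open>d\<^sup>2 - e\<^sup>2\<close>. This trades the comparator at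
      \<open>?J i\<close> for the one at \<open>?J (?J i)\<close>, so that the squares can
      telescope.\<close>
    finally have d_le: "d\<^sup>2 \<le> a (?J i) + 2 * R * v i"
      by (simp add: a_def e_def power2_eq_square algebra_simps)
    have "?g \<bullet> (best S (?J i) - bitrate S (?J i)) \<le> (d\<^sup>2 - a i) / (2 * \<alpha>) + \<alpha> / 2 * (norm ?g)\<^sup>2"
      unfolding d_def a_def
      using J run_best[of "?J i"] that
      by (intro proximal_step[OF convex_bitrate_vectors[OF assms(2)]
            closed_bitrate_vectors[OF assms(1)] assms(3) run_update]) (auto simp: N_def)
    also have "(d\<^sup>2 - a i) / (2 * \<alpha>) \<le> (a (?J i) + 2 * R * v i - a i) / (2 * \<alpha>)"
      using d_le assms(3) by (intro divide_right_mono) auto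
    also have "(norm ?g)\<^sup>2 \<le> Qbar\<^sup>2"
      using subgrad[OF J run_bitrate[of "?J i"]] J by (intro power_mono) auto
    finally show ?thesis using assms(3) by (simp add: field_simps)
  qed
  have "dynamic_regret \<beta> I E S
      \<le> (\<Sum>i\<in>N. ?c i * ((a (?J i) - a i) / (2 * \<alpha>) + R / \<alpha> * v i + \<alpha> / 2 * Qbar\<^sup>2))"
    using step
    by (intro order_trans[OF dynamic_regret_le_linearized[folded N_def]] sum_mono mult_left_mono) auto
  also have "\<dots> = (\<Sum>i\<in>N. ?c i * (a (?J i) - a i)) / (2 * \<alpha>) + R / \<alpha> * (\<Sum>i\<in>N. ?c i * v i)
      + \<alpha> / 2 * Qbar\<^sup>2 * sum ?c N"
    by (simp add: sum.distrib sum_divide_distrib sum_distrib_left algebra_simps)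
  \<comment> \<open>The telescoping bound applies with \<open>B\<close> equal to
    \<open>R\<^sup>2\<close>, which dominates every squared distance \<open>a i\<close>.\<close>
  also have "(\<Sum>i\<in>N. ?c i * (a (?J i) - a i)) \<le> 2 * R\<^sup>2 * V\<^sub>0"
  proof -
    have "(\<Sum>i\<in>N. ?c i * (a (?J i) - a i))
        \<le> 2 * R\<^sup>2 * real (card {i\<in>{1..I+1}. feedback I S i = {}})"
      unfolding N_def
      using dist_le run_Jidx_le run_viewed_index run_Jidx_feedback
      by (intro feedback_weighted_telescope) (auto simp: a_def intro!: power_mono)
    also have "real (card {i\<in>{1..I+1}. feedback I S i = {}}) \<le> V\<^sub>0"
      using empty by (simp add: sum.inter_filter[symmetric] del: sum.cl_ivl_Suc)
    finally show ?thesis by (simp add: mult_left_mono)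
  qed
  also have "(\<Sum>i\<in>N. ?c i * v i) \<le> V\<^sub>r"
    unfolding v_def
    by (intro order_trans[OF sum_mono2 drift]) (auto simp: N_def)
  also have "sum ?c N = sum ?c {1..I+1}"
    by (intro sum.mono_neutral_left) (auto simp: N_def)
  also have "\<dots> = real I"
    using sum_card_feedback[OF run_viewed_index] by simp
  finally have "dynamic_regret \<beta> I E S
      \<le> 2 * R\<^sup>2 * V\<^sub>0 / (2 * \<alpha>) + R / \<alpha> * V\<^sub>r + \<alpha> / 2 * Qbar\<^sup>2 * real I"
    using R assms(3) by (simp add: divide_right_mono mult_left_mono del: times_divide_eq_left)
  then show ?thesis by (simp add: add_divide_distrib add.commute)
qed

end

section \<open>Passage to the limit\<close>

theorem corollary1:
  fixes \<R> :: "real set"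
    and E :: "nat \<Rightarrow> 'k::{finite,linorder} stream_env"
    and S :: "nat \<Rightarrow> 'k stream_run"
    and \<beta> dmin dmax \<alpha>\<^sub>0 \<gamma> Qbar R V\<^sub>0 V\<^sub>r :: real
  assumes "bitrate_set \<R>" and "convex \<R>" and "0 < \<beta>" and "0 < dmin"
    and "\<And>I. 1 \<le> I \<Longrightarrow> valid_env dmin dmax I (E I)"
    and "0 < \<alpha>\<^sub>0" and "1 < \<gamma>"
    and "\<And>I. 1 \<le> I \<Longrightarrow> OBS360_run \<beta> \<R> I (\<alpha>\<^sub>0 * real I powr (- (1 / \<gamma>))) (E I) (S I)"
    and "\<And>I i r. 1 \<le> I \<Longrightarrow> i \<in> {1..I} \<Longrightarrow> r \<in> bitrate_vectors \<R> \<Longrightarrow>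
           norm (subgrad (S I) i r) \<le> Qbar"
    and "\<And>r r'. r \<in> (bitrate_vectors \<R> :: (real, 'k) vec set) \<Longrightarrow> r' \<in> bitrate_vectors \<R> \<Longrightarrow>
           norm (r - r') \<le> R"
    and "0 \<le> V\<^sub>0" and "0 \<le> V\<^sub>r"
    and "\<And>I. 1 \<le> I \<Longrightarrow> (\<Sum>i\<in>{1..I+1}. if feedback I (S I) i = {} then 1 else 0) \<le> V\<^sub>0"
    and "\<And>I. 1 \<le> I \<Longrightarrow> (\<Sum>i\<in>{1..I+1}. real (card (feedback I (S I) i)) *
           norm (best (S I) (Jidx (S I) i) - best (S I) (Jidx (S I) (Jidx (S I) i)))) \<le> V\<^sub>r"
  shows "(\<lambda>I. dynamic_regret \<beta> I (E I) (S I) / real I) \<longlonglongrightarrow> 0"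
proof (rule tendsto_sandwich)
  \<comment> \<open>The regret bound divided by \<open>I\<close>, with the step size inserted:
    \<open>1 / (\<alpha> * I)\<close> becomes
    \<open>I powr (1 / \<gamma> - 1) / \<alpha>\<^sub>0\<close>.\<close>
  let ?bound = "\<lambda>I. (R * V\<^sub>r + R\<^sup>2 * V\<^sub>0) / \<alpha>\<^sub>0 * real I powr (1 / \<gamma> - 1)
      + \<alpha>\<^sub>0 / 2 * Qbar\<^sup>2 * real I powr (- (1 / \<gamma>))"
  show "\<forall>\<^sub>F I in sequentially. 0 \<le> dynamic_regret \<beta> I (E I) (S I) / real I"
    using eventually_ge_at_top[of 1]
    by eventually_elim (use dynamic_regret_nonneg[OF assms(8)] in auto)
  show "\<forall>\<^sub>F I in sequentially. dynamic_regret \<beta> I (E I) (S I) / real I \<le> ?bound I"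
    using eventually_ge_at_top[of 1]
  proof eventually_elim
    case (elim I)
    let ?\<alpha> = "\<alpha>\<^sub>0 * real I powr (- (1 / \<gamma>))"
    have "closed \<R>" using assms(1) by (simp add: bitrate_set_def)
    moreover have "0 < ?\<alpha>" using elim \<open>0 < \<alpha>\<^sub>0\<close> by simp
    ultimately have "dynamic_regret \<beta> I (E I) (S I)
        \<le> (R * V\<^sub>r + R\<^sup>2 * V\<^sub>0) / ?\<alpha> + ?\<alpha> / 2 * Qbar\<^sup>2 * real I"
      using elim assms
      by (intro dynamic_regret_bound[OF assms(8)[OF elim]]) auto
    then have "dynamic_regret \<beta> I (E I) (S I) / real I
        \<le> ((R * V\<^sub>r + R\<^sup>2 * V\<^sub>0) / ?\<alpha> + ?\<alpha> / 2 * Qbar\<^sup>2 * real I) / real I"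
      by (rule divide_right_mono) simp
    also have "\<dots> = ?bound I"
      using elim \<open>0 < \<alpha>\<^sub>0\<close> by (simp add: powr_diff powr_minus field_simps)
    finally show ?case .
  qed
  \<comment> \<open>Both exponents are negative: the first because \<gamma> exceeds 1, the second
    because \<gamma> is positive.\<close>
  have "(\<lambda>I. real I powr (1 / \<gamma> - 1)) \<longlonglongrightarrow> 0" "(\<lambda>I. real I powr (- (1 / \<gamma>))) \<longlonglongrightarrow> 0"
    using \<open>1 < \<gamma>\<close> by (auto intro!: tendsto_neg_powr filterlim_real_sequentially)
  then show "?bound \<longlonglongrightarrow> 0"
    by (intro tendsto_add_zero tendsto_mult_right_zero)
qed simp

end
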